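(* Let $T(n)$ denote the number of polyiamonds consisting of exactly $n$ triangles, counted up to translation, and let $\lambda_T=\lim_{n\to\infty}\frac{T(n+1)}{T(n)}$ be the growth constant of polyiamonds. Let $z$ be the unique real root of the equation $2z^3+z^2-1=0$. Then $$\lambda_T\le 1+2z+3z^2 .$$
   Context: The triangular lattice is the regular tiling of the Euclidean plane by congruent equilateral triangles (each triangle of the tiling has one of two orientations, pointing left or pointing right). Two triangles of the tiling are adjacent if they share an edge. A polyiamond is a finite nonempty set of triangles of this tiling that is edge-connected, i.e. the graph on the set whose edges are the pairs of adjacent triangles is connected. Two polyiamonds are considered the same, and counted once, if one is a translate of the other (rotations and reflections are not identified). For $n\ge 1$, $T(n)$ is the number of polyiamonds with exactly $n$ triangles under this identification; for example $T(1)=2$ and $T(3)=6$. It is a known fact from earlier literature that the limit $\lambda_T=\lim_{n\to\infty} T(n+1)/T(n)$ exists; it also satisfies $\lambda_T=\lim_{n\to\infty}\sqrt[n]{T(n)}=\sup_n\sqrt[n]{T(n)}$ (where the supremum formula uses the known supermultiplicativity $T(\ell+m)\ge T(\ell)T(m)$ for all $\ell,m\ge1$ not both equal to $1$). *)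

theory Defs
  imports "HOL-Analysis.Analysis"
begin

text \<open>
  The Euclidean plane is \<^typ>\<open>complex\<close>. The lattice is spanned by the unit vectors at angles
  \<open>\<pi>/6\<close> and \<open>-\<pi>/6\<close>, so the edges in the third direction are vertical and the triangles
  point left or right. All triangles have side length 1.
\<close>

definition lattice_point :: "int \<Rightarrow> int \<Rightarrow> complex" where
  "lattice_point i j = of_int i * cis (pi / 6) + of_int j * cis (- (pi / 6))"

definition left_triangle :: "int \<Rightarrow> int \<Rightarrow> complex set" where
  "left_triangle i j =
     convex hull {lattice_point i j, lattice_point (i + 1) j, lattice_point i (j + 1)}"

definition right_triangle :: "int \<Rightarrow> int \<Rightarrow> complex set" where
  "right_triangle i j =
     convex hull {lattice_point (i + 1) j, lattice_point i (j + 1), lattice_point (i + 1) (j + 1)}"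

definition triangles :: "complex set set" where
  "triangles = {left_triangle i j | i j. True} \<union> {right_triangle i j | i j. True}"

definition adjacent :: "complex set \<Rightarrow> complex set \<Rightarrow> bool" where
  "adjacent s t \<longleftrightarrow> s \<noteq> t \<and> (\<exists>e. e edge_of s \<and> e edge_of t)"

definition edge_connected :: "complex set set \<Rightarrow> bool" where
  "edge_connected P \<longleftrightarrow>
     (\<forall>s\<in>P. \<forall>t\<in>P. (s, t) \<in> {(u, v). u \<in> P \<and> v \<in> P \<and> adjacent u v}\<^sup>*)"

definition polyiamond :: "complex set set \<Rightarrow> bool" where
  "polyiamond P \<longleftrightarrow> finite P \<and> P \<noteq> {} \<and> P \<subseteq> triangles \<and> edge_connected P"

definition translate :: "complex \<Rightarrow> complex set set \<Rightarrow> complex set set" where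
  "translate v P = (\<lambda>s. (+) v ` s) ` P"

definition translation_rel :: "(complex set set \<times> complex set set) set" where
  "translation_rel = {(P, Q). polyiamond P \<and> polyiamond Q \<and> (\<exists>v. Q = translate v P)}"

definition num_polyiamonds :: "nat \<Rightarrow> nat" where
  "num_polyiamonds n = card ({P. polyiamond P \<and> card P = n} // translation_rel)"

end

theory Submission
  imports Defs
begin

text \<open>
  Explore a polyiamond breadth first. A newly found triangle was entered through an edge \<open>va\<close>,
  coming from a run of triangles that turns around \<open>v\<close>; when it is processed, the triangles behind
  the edge opposite to \<open>v\<close> are collected by turning around \<open>a\<close>, as long as they belong to the
  polyiamond and are new. Of the six triangles around \<open>a\<close>, one is the current triangle, one is the
  triangle it was entered from, and the neighbour of the latter around \<open>a\<close> has always been dealt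
  with before. So every triangle contributes a number in \<open>{0, 1, 2, 3}\<close>, and the sequence of these
  numbers determines the polyiamond. Up to a bounded correction, \<open>T(n)\<close> is therefore at most the
  number of sequences of length \<open>n\<close> over \<open>{0, 1, 2, 3}\<close> with sum \<open>n\<close>, which is at most
  \<open>((1 + x + x\<^sup>2 + x\<^sup>3) / x)\<^sup>n\<close> for every \<open>x > 0\<close>. The root of \<open>2x\<^sup>3 + x\<^sup>2 - 1\<close> minimises
  this base.
\<close>

section \<open>Flags of the triangular tiling\<close>

text \<open>
  A flag \<open>(v, a, b)\<close> stands for the triangle \<open>vab\<close> with distinguished edge \<open>va\<close>, through which it was
  entered, and distinguished vertex \<open>v\<close>, around which the exploration was turning.
\<close>

type_synonym flag = "complex \<times> complex \<times> complex"

fun cell :: "flag \<Rightarrow> complex set" where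
  "cell (v, a, b) = convex hull {v, a, b}"

text \<open>
  The quadratic equation characterises equilateral triangles in the complex plane; being polynomial,
  it makes the possible third vertices over a given edge the two roots of a quadratic.
\<close>

fun equilateral :: "flag \<Rightarrow> bool" where
  "equilateral (v, a, b) \<longleftrightarrow> v \<noteq> a \<and> v\<^sup>2 + a\<^sup>2 + b\<^sup>2 = v * a + a * b + b * v"

fun swap :: "flag \<Rightarrow> flag" where
  "swap (v, a, b) = (a, v, b)"

fun reflect :: "flag \<Rightarrow> flag" where
  "reflect (v, a, b) = (v, a, v + a - b)"

text \<open>On equilateral flags this is the rotation by 60 degrees about \<open>v\<close> that
  takes \<open>a\<close> to \<open>b\<close>. As an affine formula it reduces incidences around a
  vertex to ring identities.\<close>

fun turn :: "flag \<Rightarrow> flag" where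
  "turn (v, a, b) = (v, b, v + b - a)"

lemma cell_swap: "cell (swap F) = cell F"
  by (cases F) (simp add: insert_commute)

lemma equilateral_distinct:
  assumes "equilateral (v, a, b)"
  shows "v \<noteq> a" "a \<noteq> b" "b \<noteq> v"
proof -
  have eq: "v\<^sup>2 + a\<^sup>2 + b\<^sup>2 = v * a + a * b + b * v" and va: "v \<noteq> a"
    using assms by auto
  show "v \<noteq> a" by (fact va)
  show "a \<noteq> b"
  proof
    assume "a = b"
    with eq have "(v - a) * (v - a) = 0" by algebra
    with va show False by simp
  qed
  show "b \<noteq> v"
  proof
    assume "b = v"
    with eq have "(v - a) * (v - a) = 0" by algebra
    with va show False by simp
  qed
qed

lemma equilateral_swap: "equilateral F \<Longrightarrow> equilateral (swap F)"
  by (cases F) (auto simp: algebra_simps)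

lemma equilateral_rotate: "equilateral (v, a, b) \<Longrightarrow> equilateral (a, b, v)"
  using equilateral_distinct[of v a b] by (auto simp: algebra_simps)

lemma equilateral_turn: "equilateral F \<Longrightarrow> equilateral (turn F)"
proof (cases F)
  fix v a b assume F: "F = (v, a, b)" and eq: "equilateral F"
  have "v\<^sup>2 + a\<^sup>2 + b\<^sup>2 = v * a + a * b + b * v" using F eq by simp
  then have "v\<^sup>2 + b\<^sup>2 + (v + b - a)\<^sup>2 = v * b + b * (v + b - a) + (v + b - a) * v"
    by algebra
  then show ?thesis using F eq equilateral_distinct[of v a b] by simp
qed

lemma equilateral_turn_pow: "equilateral F \<Longrightarrow> equilateral ((turn ^^ k) F)"
  by (induction k) (auto intro: equilateral_turn)

text \<open>Both \<open>b\<close> and \<open>x\<close> are roots of one quadratic whose roots sum to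
  \<open>v + a\<close>.\<close>

lemma equilateral_third_vertex:
  assumes "equilateral (v, a, b)" "equilateral (v, a, x)"
  shows "x = b \<or> x = v + a - b"
proof -
  have "v\<^sup>2 + a\<^sup>2 + b\<^sup>2 = v * a + a * b + b * v" "v\<^sup>2 + a\<^sup>2 + x\<^sup>2 = v * a + a * x + x * v"
    using assms by auto
  then have "(x - b) * (x - (v + a - b)) = 0" by algebra
  then show ?thesis by simp
qed

section \<open>Edges and neighbours of a cell\<close>

lemma equilateral_not_collinear:
  assumes "equilateral (v, a, b)"
  shows "\<not> collinear {v, a, b}"
proof
  assume "collinear {v, a, b}"
  then obtain u where u: "a = u *\<^sub>R v + (1 - u) *\<^sub>R b"
    using equilateral_distinct[OF assms] by (auto simp: collinear_3_expand)
  have a: "a = b + of_real u * (v - b)"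
    using u by (simp add: scaleR_conv_of_real algebra_simps)
  have "v\<^sup>2 + a\<^sup>2 + b\<^sup>2 = v * a + a * b + b * v" using assms by simp
  \<comment> \<open>Parametrising the line makes the quadratic equation factor; the second factor
    has negative discriminant for real \<open>u\<close>.\<close>
  with a have "(v - b)\<^sup>2 * (1 - of_real u + (of_real u)\<^sup>2) = 0" by algebra
  moreover have "v - b \<noteq> 0" using equilateral_distinct[OF assms] by simp
  ultimately have "complex_of_real (1 - u + u\<^sup>2) = 0" by simp
  then have "1 - u + u\<^sup>2 = 0" by (simp only: of_real_eq_0_iff)
  moreover have "1 - u + u\<^sup>2 = (u - 1/2)\<^sup>2 + 3/4" by (simp add: power2_eq_square algebra_simps)
  ultimately show False using zero_le_power2[of "u - 1/2"] by linarith
qed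

lemma edge_of_cell:
  assumes "equilateral (v, a, b)" and e: "e edge_of cell (v, a, b)"
  shows "e = closed_segment v a \<or> e = closed_segment a b \<or> e = closed_segment b v"
proof -
  have f: "e face_of convex hull {v, a, b}" and d: "aff_dim e = 1"
    using e by (auto simp: edge_of_def)
  obtain S where S: "S \<subseteq> {v, a, b}" "e = convex hull S"
    using face_of_convex_hull_subset[OF _ f] by (auto simp: finite_imp_compact)
  have dS: "aff_dim S = 1" using d S by (simp add: aff_dim_convex_hull)
  then have "S \<noteq> {v, a, b}"
    using equilateral_not_collinear[OF assms(1)] by (auto simp: collinear_aff_dim)
  moreover have "S \<noteq> {}" "\<And>x. S \<noteq> {x}" using dS by auto
  ultimately have "S = {v, a} \<or> S = {a, b} \<or> S = {b, v}"
    using S(1) by blast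
  then show ?thesis using S(2) by (auto simp: segment_convex_hull)
qed

lemma triangles_equilateral:
  assumes "t \<in> triangles"
  obtains F where "equilateral F" "t = cell F"
proof -
  define w where "w = cis (pi / 6)"
  define w' where "w' = cis (- (pi / 6))"
  \<comment> \<open>\<open>w / w' = cis (pi / 3)\<close> is a root of \<open>X^2 - X + 1\<close>;
    this is that relation cleared of denominators.\<close>
  have w: "w\<^sup>2 + w'\<^sup>2 = w * w'"
    by (simp add: w_def w'_def cis_mult power2_eq_square complex_eq_iff cos_60)
  have ww': "w \<noteq> w'" by (simp add: w_def w'_def complex_eq_iff sin_30)
  have w0: "w \<noteq> 0" by (simp add: w_def)
  from assms consider i j where "t = left_triangle i j" | i j where "t = right_triangle i j"
    unfolding triangles_def by blast
  then show ?thesis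
  proof cases
    case (1 i j)
    define p where "p = lattice_point i j"
    have "t = cell (p, p + w, p + w')"
      unfolding 1 left_triangle_def lattice_point_def p_def w_def w'_def
      by (simp add: algebra_simps)
    moreover have "p\<^sup>2 + (p + w)\<^sup>2 + (p + w')\<^sup>2 = p * (p + w) + (p + w) * (p + w') + (p + w') * p"
      using w by algebra
    ultimately show ?thesis using that[of "(p, p + w, p + w')"] w0 by simp
  next
    case (2 i j)
    define p where "p = lattice_point i j"
    have "t = cell (p + w, p + w', p + w + w')"
      unfolding 2 right_triangle_def lattice_point_def p_def w_def w'_def
      by (simp add: algebra_simps)
    moreover have "(p + w)\<^sup>2 + (p + w')\<^sup>2 + (p + w + w')\<^sup>2
        = (p + w) * (p + w') + (p + w') * (p + w + w') + (p + w + w') * (p + w)"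
      using w by algebra
    ultimately show ?thesis using that[of "(p + w, p + w', p + w + w')"] ww' by simp
  qed
qed

lemma adjacent_cell:
  assumes F: "equilateral F" and t: "t \<in> triangles" and adj: "adjacent (cell F) t"
  shows "t = cell (reflect F) \<or> t = cell (turn F) \<or> t = cell (turn (swap F))"
proof -
  obtain v a b where vab: "F = (v, a, b)" by (cases F)
  obtain G where G: "equilateral G" "t = cell G" using triangles_equilateral[OF t] .
  obtain e where e: "e edge_of cell F" "e edge_of cell G" and ne: "cell F \<noteq> cell G"
    using adj G by (auto simp: adjacent_def)
  obtain p q r where G0: "G = (p, q, r)" by (cases G)
  have perm: "cell (p, q, r) = cell (q, r, p)" "cell (p, q, r) = cell (r, p, q)"
    by (simp_all add: insert_commute)
  obtain x y z where xyz: "equilateral (x, y, z)" "t = cell (x, y, z)" "e = closed_segment x y"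
    using edge_of_cell[of p q r e] e(2) G G0 equilateral_rotate[of p q r]
      equilateral_rotate[of q r p] perm by metis
  \<comment> \<open>Over the common edge, a cell other than \<open>cell F\<close> must have the
    reflected third vertex; the three edges of \<open>F\<close> give the three cases.\<close>
  have third: "t = cell (v', a', v' + a' - b')"
    if "equilateral (v', a', b')" "cell F = cell (v', a', b')" "e = closed_segment v' a'" for v' a' b'
  proof -
    have "{x, y} = {v', a'}" using that(3) xyz(3) by (metis closed_segment_eq)
    then consider "x = v'" "y = a'" | "x = a'" "y = v'" by (auto simp: doubleton_eq_iff)
    then have z: "equilateral (v', a', z) \<and> t = cell (v', a', z)"
    proof cases
      case 1
      then show ?thesis using xyz by blast
    next
      case 2
      then show ?thesis
        using xyz(2) equilateral_swap[OF xyz(1)] cell_swap[of "(x, y, z)"] by simp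
    qed
    then have "z \<noteq> b'" using that(2) ne G(2) by metis
    then show ?thesis using equilateral_third_vertex[of v' a' b' z] that(1) z by blast
  qed
  have rot: "equilateral (a, b, v)" "equilateral (b, v, a)"
    using equilateral_rotate F vab by blast+
  consider "e = closed_segment v a" | "e = closed_segment a b" | "e = closed_segment b v"
    using edge_of_cell[of v a b e] e(1) F vab by auto
  then show ?thesis
  proof cases
    case 1
    then show ?thesis using third[of v a b] F vab by simp
  next
    case 2
    then show ?thesis using third[of a b v] rot vab by (simp add: insert_commute)
  next
    case 3
    then show ?thesis using third[of b v a] rot vab by (simp add: insert_commute add.commute)
  qed
qed

section \<open>Exploring a polyiamond\<close>

definition children :: "flag \<Rightarrow> nat \<Rightarrow> flag list" where
  "children F k = map (\<lambda>i. (turn ^^ Suc i) (swap F)) [0..<k]"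

text \<open>Replays the first-in first-out search from the counts alone. Only cells of children are
  returned, so that \<open>U\<close> is rebuilt, not all of \<open>P\<close>.\<close>

fun decode :: "flag list \<Rightarrow> nat list \<Rightarrow> complex set set" where
  "decode (F # q) (k # ks) = cell ` set (children F k) \<union> decode (q @ children F k) ks"
| "decode _ _ = {}"

text \<open>
  \<open>U\<close> is the set of triangles of \<open>P\<close> still to be found and \<open>q\<close> the queue of found but unprocessed
  ones. The third clause is what bounds the number of children by 3: the fourth triangle after \<open>F\<close>
  around its vertex \<open>a\<close> is known not to be in \<open>U\<close>, or it is the first child of the predecessor of
  \<open>F\<close> in its run, which will be processed before \<open>F\<close>.
\<close>

definition exploration :: "complex set set \<Rightarrow> complex set set \<Rightarrow> flag list \<Rightarrow> bool" where
  "exploration P U q \<longleftrightarrow>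
     U \<subseteq> P \<and>
     (\<forall>F\<in>set q. equilateral F \<and> cell F \<notin> U \<and> cell (turn F) \<notin> U \<and> cell (reflect F) \<notin> U) \<and>
     (\<forall>i<length q. cell ((turn ^^ 4) (swap (q ! i))) \<notin> U \<or> (\<exists>j<i. q ! i = turn (q ! j))) \<and>
     (\<forall>s\<in>U. \<forall>t\<in>P - U. adjacent t s \<longrightarrow> (\<exists>F\<in>set q. s = cell (turn (swap F))))"

lemma turn_pow_4: "(turn ^^ 4) F = turn (turn (turn (turn F)))"
  by (simp add: eval_nat_numeral)

lemma cell_reflect_turn: "cell (reflect (turn F)) = cell F"
  by (cases F) (simp add: insert_commute algebra_simps)

text \<open>For a turned flag, the fourth cell is the first child of its run predecessor; for a
  first child of \<open>F\<close> it is the cell after \<open>F\<close> in its own run. These two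
  identities preserve the third clause of \<open>exploration\<close>.\<close>

lemma fourth_turn: "cell ((turn ^^ 4) (swap (turn F))) = cell (turn (swap F))"
  by (cases F) (simp add: turn_pow_4 insert_commute algebra_simps)

lemma fourth_child: "cell ((turn ^^ 4) (swap (turn (swap F)))) = cell (turn F)"
  by (cases F) (simp add: turn_pow_4 insert_commute algebra_simps)

text \<open>The run stops at the first cell that is outside \<open>U\<close> or repeated. This rule
  builds injectivity in, so the cells around a vertex are never shown to be distinct.\<close>

lemma maximal_run:
  fixes c :: "nat \<Rightarrow> 'a"
  assumes "c m \<notin> U"
  obtains k where "k \<le> m" "c ` {..<k} \<subseteq> U" "inj_on c {..<k}" "c k \<notin> U - c ` {..<k}"
proof -
  define k where "k = (LEAST k. c k \<notin> U - c ` {..<k})"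
  have m: "c m \<notin> U - c ` {..<m}" using assms by blast
  have k: "c k \<notin> U - c ` {..<k}" unfolding k_def by (rule LeastI[of "\<lambda>k. c k \<notin> U - c ` {..<k}", OF m])
  have "k \<le> m" unfolding k_def by (rule Least_le[of "\<lambda>k. c k \<notin> U - c ` {..<k}", OF m])
  have less: "c i \<in> U - c ` {..<i}" if "i < k" for i
    using not_less_Least[OF that[unfolded k_def]] by blast
  have "inj_on c {..<k}"
  proof (rule linorder_inj_onI')
    fix i j assume "i \<in> {..<k}" "j \<in> {..<k}" "i < j"
    then have "c i \<in> c ` {..<j}" "c j \<notin> c ` {..<j}" using less[of j] by auto
    then show "c i \<noteq> c j" by metis
  qed
  moreover have "c ` {..<k} \<subseteq> U" using less by auto
  ultimately show ?thesis using that \<open>k \<le> m\<close> k by blast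
qed

lemma exploration_step:
  assumes fr: "exploration P U (H # q)" and P: "finite P" "P \<subseteq> triangles"
  obtains k where "k \<le> 3" "cell ` set (children H k) \<subseteq> U"
    "card U = card (U - cell ` set (children H k)) + k"
    "exploration P (U - cell ` set (children H k)) (q @ children H k)"
proof -
  define c where "c i = cell ((turn ^^ Suc i) (swap H))" for i
  have UP: "U \<subseteq> P"
    and A: "\<And>F. F \<in> set (H # q) \<Longrightarrow>
      equilateral F \<and> cell F \<notin> U \<and> cell (turn F) \<notin> U \<and> cell (reflect F) \<notin> U"
    and B: "\<And>i. i < length (H # q) \<Longrightarrow> cell ((turn ^^ 4) (swap ((H # q) ! i))) \<notin> U \<or>
      (\<exists>j<i. (H # q) ! i = turn ((H # q) ! j))"
    and C: "\<And>s t. s \<in> U \<Longrightarrow> t \<in> P - U \<Longrightarrow> adjacent t s \<Longrightarrow>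
      \<exists>F\<in>set (H # q). s = cell (turn (swap F))"
    using fr unfolding exploration_def by blast+
  \<comment> \<open>The head of the queue has no predecessor, and \<open>c 3\<close> is its fourth
    cell because \<open>c\<close> starts after one turn.\<close>
  have "c 3 \<notin> U" using B[of 0] by (simp add: c_def eval_nat_numeral)
  then obtain k where k: "k \<le> 3" "c ` {..<k} \<subseteq> U" "inj_on c {..<k}" "c k \<notin> U - c ` {..<k}"
    by (rule maximal_run)
  have ch: "set (children H k) = (\<lambda>i. (turn ^^ Suc i) (swap H)) ` {..<k}"
    by (auto simp: children_def)
  have cc: "cell ` set (children H k) = c ` {..<k}"
    unfolding ch image_image c_def ..
  define U' where "U' = U - c ` {..<k}"
  have sub: "U' \<subseteq> U" by (auto simp: U'_def)
  \<comment> \<open>The cell across the edge \<open>ab\<close> of \<open>H\<close> is outside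
    \<open>U\<close> if \<open>k = 0\<close> and removed otherwise; this lets \<open>H\<close> leave
    the queue.\<close>
  have c0: "c 0 \<notin> U'" using k(4) by (cases "k = 0") (auto simp: U'_def)
  have card: "card U = card U' + k"
  proof -
    have "finite U" using UP P(1) by (rule finite_subset)
    then have "card U' = card U - card (c ` {..<k})" "card (c ` {..<k}) \<le> card U"
      using k(2) by (auto simp: U'_def card_Diff_subset finite_subset intro: card_mono)
    then show ?thesis using k(3) by (simp add: card_image)
  qed
  have A': "equilateral F \<and> cell F \<notin> U' \<and> cell (turn F) \<notin> U' \<and> cell (reflect F) \<notin> U'"
    if F: "F \<in> set (q @ children H k)" for F
  proof (cases "F \<in> set q")
    case True
    then show ?thesis using A[of F] sub by auto
  next
    case False
    then obtain i where i: "i < k" "F = (turn ^^ Suc i) (swap H)"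
      using F by (auto simp: ch)
    have "equilateral F"
      unfolding i by (intro equilateral_turn_pow equilateral_swap) (use A[of H] in simp)
    moreover have "cell F \<notin> U'" using i by (auto simp: U'_def c_def)
    \<comment> \<open>Next in the run comes another child or the cell at which the run
      stopped.\<close>
    moreover have "cell (turn F) \<notin> U'"
    proof -
      have "cell (turn F) = c (Suc i)" using i by (simp add: c_def)
      then show ?thesis using k(4) i(1) by (cases "Suc i = k") (auto simp: U'_def)
    qed
    moreover have "cell (reflect F) \<notin> U'"
    proof -
      have "cell (reflect F) = cell ((turn ^^ i) (swap H))" using i by (simp add: cell_reflect_turn)
      then show ?thesis using A[of H] sub i(1) by (cases i) (auto simp: cell_swap U'_def c_def)
    qed
    ultimately show ?thesis by blast
  qed
  have B': "cell ((turn ^^ 4) (swap ((q @ children H k) ! i))) \<notin> U' \<or>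
      (\<exists>j<i. (q @ children H k) ! i = turn ((q @ children H k) ! j))"
    if i: "i < length (q @ children H k)" for i
  proof (cases "i < length q")
    case True
    consider "cell ((turn ^^ 4) (swap (q ! i))) \<notin> U" | j where "j < Suc i" "q ! i = turn ((H # q) ! j)"
      using B[of "Suc i"] True by auto
    then show ?thesis
    proof cases
      case 1
      then show ?thesis using True sub by (auto simp: nth_append)
    next
      case (2 j)
      \<comment> \<open>For \<open>j = 0\<close> the predecessor is \<open>H\<close>, whose first
        child is settled by now; otherwise positions shift by one.\<close>
      show ?thesis
      proof (cases j)
        case 0
        then have "cell ((turn ^^ 4) (swap (q ! i))) = c 0"
          using 2 by (simp add: fourth_turn c_def)
        then show ?thesis using True c0 by (simp add: nth_append)
      next
        case (Suc j')
        then show ?thesis using 2 True by (auto simp: nth_append intro!: exI[of _ j'])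
      qed
    qed
  next
    case False
    define l where "l = i - length q"
    have l: "i = length q + l" "l < k" using False i by (auto simp: l_def children_def)
    have nth: "(q @ children H k) ! (length q + m) = (turn ^^ Suc m) (swap H)" if "m < k" for m
      using that by (simp add: nth_append children_def)
    show ?thesis
    proof (cases l)
      case 0
      then have "cell ((turn ^^ 4) (swap ((q @ children H k) ! i))) = cell (turn H)"
        using l nth[of 0] by (simp add: fourth_child)
      then show ?thesis using A[of H] sub by auto
    next
      case (Suc m)
      then have "(q @ children H k) ! i = turn ((q @ children H k) ! (length q + m))"
        using l nth[of m] nth[of l] by simp
      then show ?thesis using l Suc by (intro disjI2 exI[of _ "length q + m"]) simp
    qed
  qed
  have C': "\<exists>F\<in>set (q @ children H k). s = cell (turn (swap F))"
    if s: "s \<in> U'" and t: "t \<in> P - U'" and adj: "adjacent t s" for s t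
  proof (cases "t \<in> U")
    case False
    then obtain F where F: "F \<in> set (H # q)" "s = cell (turn (swap F))"
      using C[of s t] s t adj sub by blast
    have "F \<noteq> H" using F(2) s c0 by (auto simp: c_def)
    then show ?thesis using F by auto
  next
    \<comment> \<open>A cell just removed is a child, and its neighbours still in \<open>U'\<close>
      can only lie across its third edge.\<close>
    case True
    then obtain F where F: "F \<in> set (children H k)" "t = cell F"
      using t cc unfolding U'_def by blast
    have "s \<in> triangles" using s sub UP P(2) by blast
    then have "s = cell (reflect F) \<or> s = cell (turn F) \<or> s = cell (turn (swap F))"
      using adjacent_cell[of F s] A'[of F] F adj by simp
    then show ?thesis using A'[of F] F s by auto
  qed
  have "exploration P U' (q @ children H k)"
    unfolding exploration_def using A' B' C' sub UP by blast
  then show ?thesis using that[of k] k(1,2) card cc unfolding U'_def by simp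
qed

text \<open>A step removes \<open>k\<close> cells from \<open>U\<close> and changes the queue length
  by \<open>k - 1\<close>, so the measure drops by one and counts the flags to be processed. An
  empty queue leaves no adjacency from \<open>P - U\<close> into \<open>U\<close>, and connectedness
  forces \<open>U = {}\<close>.\<close>

lemma exploration_decode:
  assumes "exploration P U q" "finite P" "P \<subseteq> triangles" "edge_connected P" "P - U \<noteq> {}"
  shows "\<exists>ks. length ks = card U + length q \<and> set ks \<subseteq> {..3} \<and> sum_list ks = card U \<and>
    U = decode q ks"
  using assms
proof (induction "card U + length q" arbitrary: U q rule: less_induct)
  case less
  have UP: "U \<subseteq> P" using less.prems(1) by (simp add: exploration_def)
  show ?case
  proof (cases q)
    case Nil
    obtain t where t: "t \<in> P - U" using less.prems(5) by blast
    have "U = {}"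
    proof (rule ccontr)
      assume "U \<noteq> {}"
      then obtain s where s: "s \<in> U" by blast
      have "(t, s) \<in> {(u, v). u \<in> P \<and> v \<in> P \<and> adjacent u v}\<^sup>*"
        using less.prems(4) t s UP by (auto simp: edge_connected_def)
      then have "s \<in> P - U"
        by (induction rule: rtrancl_induct)
          (use t less.prems(1) Nil in \<open>auto simp: exploration_def\<close>)
      then show False using s by blast
    qed
    then show ?thesis using Nil by simp
  next
    case (Cons H q')
    obtain k where k: "k \<le> 3" "cell ` set (children H k) \<subseteq> U"
      "card U = card (U - cell ` set (children H k)) + k"
      "exploration P (U - cell ` set (children H k)) (q' @ children H k)"
      using exploration_step less.prems Cons by metis
    define U' where "U' = U - cell ` set (children H k)"
    have len: "length (q' @ children H k) = length q' + k" by (simp add: children_def)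
    have cU: "card U = card U' + k" using k(3) by (simp add: U'_def)
    have "P - U' \<noteq> {}" using less.prems(5) unfolding U'_def by blast
    moreover have "card U' + length (q' @ children H k) < card U + length q"
      using len cU Cons by simp
    ultimately obtain ks where ks: "length ks = card U' + length q' + k" "set ks \<subseteq> {..3}"
      "sum_list ks = card U'" "U' = decode (q' @ children H k) ks"
      using less.hyps[of U' "q' @ children H k"] k(4) less.prems(2-4) len
      unfolding U'_def[symmetric] by (metis add.assoc)
    have "U = decode q (k # ks)" using ks(4) k(2) Cons unfolding U'_def by (simp del: cell.simps) blast
    then show ?thesis using ks k(1) Cons cU by (intro exI[of _ "k # ks"]) auto
  qed
qed


section \<open>Counting codes\<close>

lemma sum_power_lists:
  fixes x :: real
  assumes "finite A"
  shows "(\<Sum>ks | set ks \<subseteq> A \<and> length ks = N. x ^ sum_list ks) = (\<Sum>k\<in>A. x ^ k) ^ N"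
proof (induction N)
  case 0
  have "{ks. set ks \<subseteq> A \<and> length ks = 0} = {[]}" by auto
  then show ?case by simp
next
  case (Suc N)
  let ?L = "{ks. set ks \<subseteq> A \<and> length ks = N}"
  have "(\<Sum>ks | set ks \<subseteq> A \<and> length ks = Suc N. x ^ sum_list ks)
      = (\<Sum>(ks, k)\<in>?L \<times> A. x ^ sum_list ks * x ^ k)"
    unfolding lists_length_Suc_eq
    by (subst sum.reindex) (auto simp: inj_on_def power_add mult.commute intro!: sum.cong)
  also have "\<dots> = (\<Sum>ks\<in>?L. x ^ sum_list ks) * (\<Sum>k\<in>A. x ^ k)"
    by (simp add: sum_product sum.cartesian_product)
  finally show ?case using Suc.IH by simp
qed

text \<open>Every counted list has weight \<open>x ^ m\<close> and all weights are nonnegative, so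
  one coefficient of the generating function is bounded by its value at \<open>x\<close>.\<close>

lemma card_lists_sum_list:
  fixes x :: real
  assumes "finite A" "x > 0"
  shows "real (card {ks. set ks \<subseteq> A \<and> length ks = N \<and> sum_list ks = m})
    \<le> (\<Sum>k\<in>A. x ^ k) ^ N / x ^ m"
proof -
  let ?K = "{ks. set ks \<subseteq> A \<and> length ks = N \<and> sum_list ks = m}"
  have "real (card ?K) * x ^ m = (\<Sum>ks\<in>?K. x ^ sum_list ks)" by simp
  also have "\<dots> \<le> (\<Sum>ks | set ks \<subseteq> A \<and> length ks = N. x ^ sum_list ks)"
    using assms by (intro sum_mono2 finite_lists_length_eq) auto
  finally show ?thesis using assms by (simp add: sum_power_lists field_simps)
qed

section \<open>From an exponential bound to the limit of ratios\<close>

lemma ratio_limit_le: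
  fixes t :: "nat \<Rightarrow> real"
  assumes lim: "(\<lambda>n. t (n + 1) / t n) \<longlonglongrightarrow> L"
    and nonneg: "\<And>n. t n \<ge> 0"
    and bound: "\<And>n. t n \<le> C * real (n + 1) * r ^ n"
    and r: "r > 0"
  shows "L \<le> r"
proof (rule ccontr)
  assume "\<not> L \<le> r"
  \<comment> \<open>Ratios eventually above \<open>s\<close> force growth at least like
    \<open>s ^ n\<close>, against the bound, since \<open>n * (r / s) ^ n\<close> tends to
    0.\<close>
  then obtain s where s: "r < s" "s < L" using dense[of r L] by auto
  have "eventually (\<lambda>n. t (n + 1) / t n > s) sequentially"
    using order_tendstoD(1)[OF lim s(2)] .
  then obtain N where N: "\<And>n. n \<ge> N \<Longrightarrow> t (n + 1) / t n > s"
    by (auto simp: eventually_sequentially)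
  have pos: "t n > 0" if "n \<ge> N" for n
  proof -
    have "t n \<noteq> 0" using N[OF that] s r by auto
    then show ?thesis using nonneg[of n] by simp
  qed
  have grow: "t (N + k) \<ge> t N * s ^ k" for k
  proof (induction k)
    case (Suc k)
    have "t (N + k + 1) > s * t (N + k)"
      using N[of "N + k"] pos[of "N + k"] by (simp add: field_simps)
    moreover have "s * t (N + k) \<ge> s * (t N * s ^ k)"
      using Suc s r by (intro mult_left_mono) auto
    ultimately show ?case by (simp add: mult_ac)
  qed simp
  have le: "t N \<le> C * r ^ N * (real (N + k + 1) * (r / s) ^ k)" for k
  proof -
    have "t N * s ^ k \<le> C * real (N + k + 1) * r ^ (N + k)"
      using grow[of k] bound[of "N + k"] by simp
    then show ?thesis using s r by (simp add: field_simps power_add power_divide)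
  qed
  have q: "norm (r / s) < 1" using s r by simp
  have "(\<lambda>k. real (N + 1) * (r / s) ^ k + real k * (r / s) ^ k) \<longlonglongrightarrow> real (N + 1) * 0 + 0"
    by (intro tendsto_intros LIMSEQ_power_zero[OF q] powser_times_n_limit_0[OF q])
  then have "(\<lambda>k. real (N + k + 1) * (r / s) ^ k) \<longlonglongrightarrow> 0"
    by (simp add: algebra_simps)
  then have "(\<lambda>k. C * r ^ N * (real (N + k + 1) * (r / s) ^ k)) \<longlonglongrightarrow> C * r ^ N * 0"
    by (rule tendsto_mult_left)
  then have "t N \<le> C * r ^ N * 0" by (rule LIMSEQ_le_const) (use le in auto)
  then show False using pos[of N] by simp
qed

section \<open>The real root of the cubic\<close>

lemma cubic_root_pos:
  fixes x :: real
  assumes "2 * x ^ 3 + x ^ 2 - 1 = 0"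
  shows "x > 0"
proof (rule ccontr)
  assume "\<not> x > 0"
  then have "x \<le> 0" by simp
  \<comment> \<open>For \<open>x \<le> 0\<close> both factors turn out to be at most 1, so both
    equal 1, which is absurd.\<close>
  have "x ^ 2 * (2 * x + 1) = 1"
    using assms by (simp add: algebra_simps power2_eq_square power3_eq_cube)
  moreover then have "2 * x + 1 > 0" by (smt (verit) zero_le_power2 mult_nonneg_nonpos)
  moreover then have "x ^ 2 \<le> 1 ^ 2" using \<open>x \<le> 0\<close> by (intro abs_le_square_iff[THEN iffD1]) auto
  moreover have "x ^ 2 * (2 * x + 1) \<le> x ^ 2 * 1" using \<open>x \<le> 0\<close> by (intro mult_left_mono) auto
  ultimately have "x ^ 2 = 1" by simp
  then show False using \<open>x ^ 2 * (2 * x + 1) = 1\<close> \<open>x \<le> 0\<close> by simp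
qed

lemma cubic_unique_root: "\<exists>!x::real. 2 * x ^ 3 + x ^ 2 - 1 = 0"
proof -
  have "\<exists>x\<ge>0. x \<le> 1 \<and> 2 * x ^ 3 + x ^ 2 - 1 = (0::real)"
    by (intro IVT) (auto intro!: continuous_intros)
  then obtain x :: real where x: "2 * x ^ 3 + x ^ 2 - 1 = 0" by blast
  have less: False if "2 * x ^ 3 + x ^ 2 - 1 = 0" "2 * y ^ 3 + y ^ 2 - 1 = 0" "x < y" for x y :: real
  proof -
    have "x ^ 3 < y ^ 3" "x ^ 2 < y ^ 2"
      using that cubic_root_pos[OF that(1)] by (auto intro!: power_strict_mono)
    then show False using that by simp
  qed
  show ?thesis
    using x less by (metis linorder_neqE)
qed

section \<open>Translation classes\<close>

lemma translate_add: "translate v (translate w P) = translate (v + w) P"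
  by (simp add: translate_def image_image add.assoc)

lemma adjacent_translate:
  assumes "adjacent s t"
  shows "adjacent ((+) v ` s) ((+) v ` t)"
proof -
  obtain e where "e edge_of s" "e edge_of t" "s \<noteq> t" using assms by (auto simp: adjacent_def)
  then have "(+) v ` e edge_of (+) v ` s" "(+) v ` e edge_of (+) v ` t" "(+) v ` s \<noteq> (+) v ` t"
    by (auto simp: edge_of_def face_of_translation_eq aff_dim_translation_eq inj_image_eq_iff)
  then show ?thesis unfolding adjacent_def by blast
qed

lemma lattice_point_add: "lattice_point i j + lattice_point k l = lattice_point (i + k) (j + l)"
  by (simp add: lattice_point_def algebra_simps)

lemma translate_left_triangle:
  "(+) (lattice_point k l) ` left_triangle i j = left_triangle (k + i) (l + j)"
  by (simp add: left_triangle_def lattice_point_add add.assoc flip: convex_hull_translation)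

lemma translate_right_triangle:
  "(+) (lattice_point k l) ` right_triangle i j = right_triangle (k + i) (l + j)"
  by (simp add: right_triangle_def lattice_point_add add.assoc flip: convex_hull_translation)

lemma polyiamond_translate:
  assumes "polyiamond P"
  shows "polyiamond (translate (lattice_point k l) P)"
proof -
  let ?v = "lattice_point k l"
  let ?R = "\<lambda>P. {(u, v). u \<in> P \<and> v \<in> P \<and> adjacent u v}"
  have path: "((+) ?v ` s, (+) ?v ` t) \<in> (?R (translate ?v P))\<^sup>*" if "(s, t) \<in> (?R P)\<^sup>*" for s t
    using that
  proof (induction rule: rtrancl_induct)
    case (step t u)
    then have "((+) ?v ` t, (+) ?v ` u) \<in> ?R (translate ?v P)"
      by (auto simp: translate_def intro: adjacent_translate)
    with step.IH show ?case by (rule rtrancl_into_rtrancl)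
  qed simp
  have "edge_connected (translate ?v P)"
    unfolding edge_connected_def
  proof (intro ballI)
    fix s' t' assume "s' \<in> translate ?v P" "t' \<in> translate ?v P"
    then obtain s t where "s \<in> P" "t \<in> P" "s' = (+) ?v ` s" "t' = (+) ?v ` t"
      by (auto simp: translate_def)
    then show "(s', t') \<in> (?R (translate ?v P))\<^sup>*"
      using assms path[of s t] by (simp add: polyiamond_def edge_connected_def)
  qed
  moreover have "translate ?v P \<subseteq> triangles"
  proof
    fix t assume "t \<in> translate ?v P"
    then obtain s where s: "s \<in> triangles" "t = (+) ?v ` s"
      using assms by (auto simp: translate_def polyiamond_def)
    then show "t \<in> triangles"
      unfolding triangles_def using translate_left_triangle translate_right_triangle by blast
  qed
  ultimately show ?thesis using assms by (auto simp: polyiamond_def translate_def)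
qed

lemma card_translate: "card (translate v P) = card P"
  unfolding translate_def by (rule card_image) (auto simp: inj_on_def inj_image_eq_iff)

lemma translation_class_eq:
  assumes "polyiamond P" "polyiamond (translate v P)"
  shows "translation_rel `` {translate v P} = translation_rel `` {P}"
proof -
  \<comment> \<open>Any translate of \<open>P\<close> is also a translate of the shifted
    copy.\<close>
  have "\<exists>u. translate w P = translate (u + v) P" for w
    by (rule exI[of _ "w - v"]) simp
  then show ?thesis
    using assms by (auto simp: translation_rel_def translate_add)
qed

text \<open>Contains a representative of every class. Two base triangles occur because lattice
  translations preserve orientation; repeated classes are harmless for an upper bound.\<close>

definition rooted :: "nat \<Rightarrow> complex set set set" where
  "rooted n = {P. polyiamond P \<and> card P = n \<and> (left_triangle 0 0 \<in> P \<or> right_triangle 0 0 \<in> P)}"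

lemma num_polyiamonds_le_rooted:
  assumes "finite (rooted n)"
  shows "num_polyiamonds n \<le> card (rooted n)"
proof -
  let ?A = "{P. polyiamond P \<and> card P = n}"
  have "?A // translation_rel \<subseteq> (\<lambda>P. translation_rel `` {P}) ` rooted n"
  proof
    fix X assume "X \<in> ?A // translation_rel"
    then obtain P where P: "polyiamond P" "card P = n" "X = translation_rel `` {P}"
      by (auto simp: quotient_def)
    then obtain s where s: "s \<in> P" "s \<in> triangles" by (auto simp: polyiamond_def)
    then obtain i j where ij: "s = left_triangle i j \<or> s = right_triangle i j"
      by (auto simp: triangles_def)
    let ?v = "lattice_point (-i) (-j)"
    have "(+) ?v ` s \<in> translate ?v P" using s by (auto simp: translate_def)
    then have "translate ?v P \<in> rooted n"
      using ij P polyiamond_translate[of P "-i" "-j"]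
      by (auto simp: rooted_def card_translate translate_left_triangle translate_right_triangle)
    moreover have "X = translation_rel `` {translate ?v P}"
      using translation_class_eq[of P ?v] P polyiamond_translate by simp
    ultimately show "X \<in> (\<lambda>P. translation_rel `` {P}) ` rooted n" by blast
  qed
  then show ?thesis
    unfolding num_polyiamonds_def using assms by (meson card_image_le card_mono finite_imageI le_trans)
qed

section \<open>The upper bound\<close>

text \<open>
  The flags of the hexagon around \<open>v\<close> and of the hexagon around \<open>a\<close>, without \<open>F\<close> itself: the state
  after \<open>F\<close> has been processed with all possible triangles present. Starting from it, the invariant
  holds without an exceptional first step.
\<close>

definition seed :: "flag \<Rightarrow> flag list" where
  "seed F = map (\<lambda>i. (turn ^^ Suc i) F) [0..<5] @ map (\<lambda>i. (turn ^^ Suc i) (swap F)) [0..<4]"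

text \<open>Queued cells may lie outside \<open>P\<close>: the invariant only asks that they and the
  cells next to them be absent from \<open>U\<close>, which holds since \<open>U\<close> avoids all
  ten positions.\<close>

lemma exploration_seed:
  assumes F: "equilateral F" and P: "P \<subseteq> triangles"
  shows "exploration P (P - cell ` set (F # seed F)) (seed F)"
proof -
  define D where "D = cell ` set (F # seed F)"
  have seed: "seed F = [turn F, turn (turn F), turn (turn (turn F)), turn (turn (turn (turn F))),
      turn (turn (turn (turn (turn F)))), turn (swap F), turn (turn (swap F)), turn (turn (turn (swap F))),
      turn (turn (turn (turn (swap F))))]"
    by (simp add: seed_def eval_nat_numeral upt_rec)
  have turn6: "turn (turn (turn (turn (turn (turn F))))) = F"
    by (cases F) (simp add: algebra_simps)
  have reflect: "cell (reflect F) = cell (turn (turn (turn (turn (turn F)))))"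
    by (cases F) (simp add: insert_commute algebra_simps)
  have swap5: "cell (turn (turn (turn (turn (turn (swap F)))))) = cell (turn (turn (turn (turn (turn F)))))"
    by (cases F) (simp add: insert_commute algebra_simps)
  have A: "\<forall>G\<in>set (seed F). equilateral G \<and> cell G \<in> D \<and> cell (turn G) \<in> D \<and> cell (reflect G) \<in> D"
    unfolding D_def seed
    by (simp add: turn6 swap5 cell_reflect_turn cell_swap equilateral_turn equilateral_swap F
        del: cell.simps equilateral.simps)
  have B: "cell ((turn ^^ 4) (swap (seed F ! i))) \<in> D \<or> (\<exists>j<i. seed F ! i = turn (seed F ! j))"
    if "i < length (seed F)" for i
  proof -
    have "i < 9" using that by (simp add: seed)
    \<comment> \<open>Positions 0 and 5 start the two runs; every other flag is turned from the one
      before it.\<close>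
    then have "i = 0 \<or> i = 5 \<or> i \<in> Suc ` {0, 1, 2, 3, 5, 6, 7}" by auto
    then consider "i = 0" | "i = 5" | j where "i = Suc j" "j \<in> {0, 1, 2, 3, 5, 6, 7}"
      by blast
    then show ?thesis
    proof cases
      case 1
      then show ?thesis unfolding D_def by (simp add: seed fourth_turn)
    next
      case 2
      then show ?thesis unfolding D_def by (simp add: seed fourth_child)
    next
      case (3 j)
      then have "seed F ! i = turn (seed F ! j)" by (auto simp: seed)
      then show ?thesis using 3 by blast
    qed
  qed
  have C: "\<exists>G\<in>set (seed F). s = cell (turn (swap G))"
    if s: "s \<in> P - D" and t: "t \<in> D" and adj: "adjacent t s" for s t
  proof -
    obtain G where G: "G \<in> set (F # seed F)" "t = cell G" using t unfolding D_def by blast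
    have eq: "equilateral G" using G A F by auto
    have "s \<in> triangles" using s P by blast
    then have *: "s = cell (reflect G) \<or> s = cell (turn G) \<or> s = cell (turn (swap G))"
      using adjacent_cell[OF eq] adj G by blast
    have "cell (reflect F) \<in> D" "cell (turn F) \<in> D" "cell (turn (swap F)) \<in> D"
      unfolding D_def seed reflect by simp_all
    then show ?thesis using * G A s by auto
  qed
  show ?thesis
    unfolding exploration_def D_def[symmetric] using A B C by blast
qed

text \<open>\<open>P\<close> is determined by its trace on \<open>D\<close>, one of at most
  \<open>2 ^ 10\<close> sets, and the code of \<open>P - D\<close>, of length \<open>m + 9\<close>
  and sum \<open>m \<le> n\<close>.\<close>

lemma card_rooted:
  fixes x :: real
  assumes x: "x > 0" and ge: "(\<Sum>k\<le>3. x ^ k) / x \<ge> 1"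
  shows "finite (rooted n)"
    and "real (card (rooted n))
      \<le> 2 ^ 10 * (\<Sum>k\<le>3. x ^ k) ^ 9 * real (n + 1) * ((\<Sum>k\<le>3. x ^ k) / x) ^ n"
proof -
  define w where "w = cis (pi / 6)"
  define w' where "w' = cis (- (pi / 6))"
  define F :: flag where "F = (w, 0, w')"
  define D where "D = cell ` set (F # seed F)"
  define S where "S = (\<Sum>k\<le>3. x ^ k)"
  define K where "K m = {ks. set ks \<subseteq> {..3::nat} \<and> length ks = m + 9 \<and> sum_list ks = m}" for m
  have "w\<^sup>2 + w'\<^sup>2 = w * w'"
    by (simp add: w_def w'_def cis_mult power2_eq_square complex_eq_iff cos_60)
  then have F: "equilateral F" by (simp add: F_def w_def)
  have "left_triangle 0 0 = cell F"
    by (simp add: left_triangle_def lattice_point_def F_def w_def w'_def insert_commute)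
  moreover have "right_triangle 0 0 = cell (turn F)"
    by (simp add: right_triangle_def lattice_point_def F_def w_def w'_def insert_commute)
  moreover have "turn F \<in> set (seed F)" by (auto simp: seed_def intro!: image_eqI[of _ _ 0])
  ultimately have root: "left_triangle 0 0 \<in> D" "right_triangle 0 0 \<in> D"
    by (auto simp: D_def)
  have finD: "finite D" by (simp add: D_def)
  have lenS: "length (seed F) = 9" by (simp add: seed_def)
  have cardD: "card D \<le> 10"
    using card_image_le[of "set (F # seed F)" cell] card_length[of "F # seed F"] lenS
    by (simp add: D_def)
  have finK: "finite (K m)" for m
    by (rule finite_subset[OF _ finite_lists_length_eq[of "{..3}" "m + 9"]]) (auto simp: K_def)
  let ?I = "Pow D \<times> (\<Union>m\<le>n. K m)"
  have sub: "rooted n \<subseteq> (\<lambda>(X, ks). X \<union> decode (seed F) ks) ` ?I"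
  proof
    fix P assume P: "P \<in> rooted n"
    then have PP: "finite P" "P \<subseteq> triangles" "edge_connected P" "card P = n"
      by (auto simp: rooted_def polyiamond_def)
    have "P - (P - D) \<noteq> {}" using P root by (auto simp: rooted_def)
    moreover have "exploration P (P - D) (seed F)"
      unfolding D_def by (rule exploration_seed[OF F PP(2)])
    ultimately obtain ks where ks: "length ks = card (P - D) + 9" "set ks \<subseteq> {..3}"
      "sum_list ks = card (P - D)" "P - D = decode (seed F) ks"
      using exploration_decode[of P "P - D" "seed F"] PP lenS by metis
    have "card (P - D) \<le> n" using PP by (auto intro: card_mono)
    then have "(P \<inter> D, ks) \<in> ?I" using ks by (auto simp: K_def)
    moreover have "P = (P \<inter> D) \<union> decode (seed F) ks" using ks(4) by blast
    ultimately show "P \<in> (\<lambda>(X, ks). X \<union> decode (seed F) ks) ` ?I"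
      by (intro image_eqI[of _ _ "(P \<inter> D, ks)"]) auto
  qed
  have finI: "finite ?I" using finD finK by auto
  show "finite (rooted n)" using finite_subset[OF sub] finI by blast
  have "card (rooted n) \<le> card ?I" using surj_card_le[OF finI sub] .
  also have "\<dots> \<le> 2 ^ 10 * (\<Sum>m\<le>n. card (K m))"
  proof -
    have "card (Pow D) \<le> 2 ^ 10"
      unfolding card_Pow[OF finD] by (rule power_increasing[OF cardD]) simp
    moreover have "card (\<Union>m\<le>n. K m) \<le> (\<Sum>m\<le>n. card (K m))" by (rule card_UN_le) simp
    ultimately show ?thesis unfolding card_cartesian_product by (rule mult_le_mono)
  qed
  finally have "real (card (rooted n)) \<le> real (2 ^ 10 * (\<Sum>m\<le>n. card (K m)))"
    by (rule of_nat_mono)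
  also have "\<dots> = 2 ^ 10 * (\<Sum>m\<le>n. real (card (K m)))" by simp
  also have "\<dots> \<le> 2 ^ 10 * (\<Sum>m\<le>n. S ^ 9 * (S / x) ^ n)"
  proof (intro mult_left_mono sum_mono)
    fix m assume m: "m \<in> {..n}"
    have S0: "S \<ge> 0" using x by (auto simp: S_def intro!: sum_nonneg)
    have "real (card (K m)) \<le> S ^ (m + 9) / x ^ m"
      unfolding K_def S_def using card_lists_sum_list[of "{..3}" x "m + 9" m] x by simp
    also have "\<dots> = S ^ 9 * (S / x) ^ m" by (simp add: power_add power_divide)
    \<comment> \<open>As the base is at least 1, the bound for \<open>n\<close> serves all
      \<open>m \<le> n\<close>; summing gives the factor \<open>n + 1\<close>.\<close>
    also have "\<dots> \<le> S ^ 9 * (S / x) ^ n"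
      using m ge S0 by (intro mult_left_mono power_increasing) (auto simp: S_def)
    finally show "real (card (K m)) \<le> S ^ 9 * (S / x) ^ n" .
  qed simp
  finally show "real (card (rooted n))
      \<le> 2 ^ 10 * (\<Sum>k\<le>3. x ^ k) ^ 9 * real (n + 1) * ((\<Sum>k\<le>3. x ^ k) / x) ^ n"
    by (simp add: S_def mult_ac)
qed

theorem theorem1:
  fixes lambda_T z :: real
  assumes "(\<lambda>n. real (num_polyiamonds (n + 1)) / real (num_polyiamonds n)) \<longlonglongrightarrow> lambda_T"
    and "z = (THE x::real. 2 * x ^ 3 + x ^ 2 - 1 = 0)"
  shows "lambda_T \<le> 1 + 2 * z + 3 * z ^ 2"
proof -
  have z: "2 * z ^ 3 + z ^ 2 - 1 = 0"
    unfolding assms(2) by (rule theI'[OF cubic_unique_root])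
  then have pos: "z > 0" by (rule cubic_root_pos)
  let ?S = "\<Sum>k\<le>3. z ^ k"
  let ?r = "1 + 2 * z + 3 * z ^ 2"
  \<comment> \<open>\<open>?r\<close> is the derivative of \<open>1 + x + x^2 + x^3\<close> at
    \<open>z\<close>; the cubic says precisely that \<open>z\<close> is a critical point of that
    polynomial divided by \<open>x\<close>.\<close>
  have "?S = z * ?r"
    using z by (simp add: eval_nat_numeral algebra_simps)
  then have r: "?S / z = ?r" using pos by simp
  have r1: "?r \<ge> 1" using pos by simp
  have bound: "real (num_polyiamonds n) \<le> 2 ^ 10 * ?S ^ 9 * real (n + 1) * ?r ^ n" for n
  proof -
    have "finite (rooted n)" "real (card (rooted n)) \<le> 2 ^ 10 * ?S ^ 9 * real (n + 1) * ?r ^ n"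
      using card_rooted[of z n] pos r r1 by simp_all
    then show ?thesis using num_polyiamonds_le_rooted[of n] by linarith
  qed
  show ?thesis
    by (rule ratio_limit_le[OF assms(1) _ bound]) (use r1 in auto)
qed

end
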